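(* Assume Matiyasevich's conjecture: for every positive integer $n$, every recursively enumerable set $\mathcal{M}\subseteq \mathbb{N}^n$ has a finite-fold Diophantine representation. Then for every computable function $f:\mathbb{N}\to\mathbb{N}$ there is a positive integer $m(f)$ such that for each integer $n\ge m(f)$ there exists a system $S\subseteq E_n$ which has at least $f(n)$ and at most finitely many solutions in integers $x_1,\ldots,x_n$.
   Context: $\mathbb{N}=\{0,1,2,\ldots\}$. For a positive integer $n$, $E_n=\{x_i=1,\ x_i+x_j=x_k,\ x_i\cdot x_j=x_k:\ i,j,k\in\{1,\ldots,n\}\}$; a system $S\subseteq E_n$ is a set of such equations in the variables $x_1,\ldots,x_n$, and a solution is a tuple $(x_1,\ldots,x_n)$ satisfying all of them. A Diophantine representation of $\mathcal{M}\subseteq\mathbb{N}^n$ is a polynomial $W$ with integer coefficients such that for all $(a_1,\ldots,a_n)\in\mathbb{N}^n$: $(a_1,\ldots,a_n)\in\mathcal{M}\iff \exists x_1,\ldots,x_m\in\mathbb{N}\ W(a_1,\ldots,a_n,x_1,\ldots,x_m)=0$. It is finite-fold if for all $a_1,\ldots,a_n\in\mathbb{N}$ the equation $W(a_1,\ldots,a_n,x_1,\ldots,x_m)=0$ has at most finitely many solutions $(x_1,\ldots,x_m)\in\mathbb{N}^m$. *)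

theory Defs
  imports Main "HOL-Library.FuncSet" "HOL-Library.Poly_Mapping"
begin

section \<open>Partial recursive functions\<close>

datatype recf =
    Zero
  | Succ
  | Proj nat
  | Comp recf "recf list"
  | PrimRec recf recf
  | Mu recf

text \<open>\<open>arity n r\<close>: the term \<open>r\<close> denotes a partial function of \<open>n\<close> arguments.
  \<open>Zero\<close> denotes the constant zero function of every arity, and the arguments of
  \<open>Proj\<close> are counted from 0.\<close>

inductive arity :: "nat \<Rightarrow> recf \<Rightarrow> bool" where
  arity_Zero: "arity n Zero"
| arity_Succ: "arity 1 Succ"
| arity_Proj: "i < n \<Longrightarrow> arity n (Proj i)"
| arity_Comp: "arity (length gs) f \<Longrightarrow> (\<forall>g\<in>set gs. arity n g) \<Longrightarrow> arity n (Comp f gs)"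
| arity_PrimRec: "arity n f \<Longrightarrow> arity (Suc (Suc n)) g \<Longrightarrow> arity (Suc n) (PrimRec f g)"
| arity_Mu: "arity (Suc n) f \<Longrightarrow> arity n (Mu f)"

text \<open>\<open>evals r xs y\<close>: the partial function denoted by \<open>r\<close> is defined at \<open>xs\<close> and has the
  value \<open>y\<close> there.  In primitive recursion the recursion variable comes first and the step
  function receives it together with the previous value. Minimisation runs over the first
  argument and requires all earlier values to be defined and nonzero.\<close>

inductive evals :: "recf \<Rightarrow> nat list \<Rightarrow> nat \<Rightarrow> bool" where
  evals_Zero: "evals Zero xs 0"
| evals_Succ: "evals Succ [x] (Suc x)"
| evals_Proj: "i < length xs \<Longrightarrow> evals (Proj i) xs (xs ! i)"
| evals_Comp: "length ys = length gs \<Longrightarrow> (\<forall>i<length gs. evals (gs ! i) xs (ys ! i)) \<Longrightarrow>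
    evals f ys z \<Longrightarrow> evals (Comp f gs) xs z"
| evals_PrimRec_0: "evals f xs y \<Longrightarrow> evals (PrimRec f g) (0 # xs) y"
| evals_PrimRec_Suc: "evals (PrimRec f g) (k # xs) y \<Longrightarrow> evals g (k # y # xs) z \<Longrightarrow>
    evals (PrimRec f g) (Suc k # xs) z"
| evals_Mu: "evals f (k # xs) 0 \<Longrightarrow> (\<forall>j<k. \<exists>y. evals f (j # xs) (Suc y)) \<Longrightarrow>
    evals (Mu f) xs k"

definition computable :: "(nat \<Rightarrow> nat) \<Rightarrow> bool" where
  "computable f \<longleftrightarrow> (\<exists>r. arity 1 r \<and> (\<forall>x y. evals r [x] y \<longleftrightarrow> y = f x))"

text \<open>Elements of \<open>\<nat>\<^sup>n\<close> are lists of length \<open>n\<close>. A recursively enumerable set is the domain of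
  a partial recursive function.\<close>

definition tuples :: "nat \<Rightarrow> nat list set" where
  "tuples n = {xs. length xs = n}"

definition recursively_enumerable :: "nat \<Rightarrow> nat list set \<Rightarrow> bool" where
  "recursively_enumerable n M \<longleftrightarrow>
     M \<subseteq> tuples n \<and>
     (\<exists>r. arity n r \<and> (\<forall>xs\<in>tuples n. xs \<in> M \<longleftrightarrow> (\<exists>y. evals r xs y)))"

section \<open>Diophantine representations\<close>

text \<open>A monomial maps the (finitely many) variables occurring in it to their exponents; a
  polynomial maps its (finitely many) monomials to their integer coefficients.\<close>

type_synonym int_mpoly = "(nat \<Rightarrow>\<^sub>0 nat) \<Rightarrow>\<^sub>0 int"

definition mpoly_vars :: "int_mpoly \<Rightarrow> nat set" where
  "mpoly_vars W = (\<Union>m\<in>Poly_Mapping.keys W. Poly_Mapping.keys m)"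

definition mpoly_eval :: "int_mpoly \<Rightarrow> (nat \<Rightarrow> int) \<Rightarrow> int" where
  "mpoly_eval W v =
     (\<Sum>m\<in>Poly_Mapping.keys W. Poly_Mapping.lookup W m *
        (\<Prod>i\<in>Poly_Mapping.keys m. v i ^ Poly_Mapping.lookup m i))"

text \<open>\<open>mpoly_at W xs\<close> is the value of \<open>W\<close> when variable \<open>i < length xs\<close> is set to \<open>xs ! i\<close>;
  it is used only for polynomials in these variables.\<close>

definition mpoly_at :: "int_mpoly \<Rightarrow> nat list \<Rightarrow> int" where
  "mpoly_at W xs = mpoly_eval W (\<lambda>i. int (xs ! i))"

definition diophantine_representation ::
    "nat \<Rightarrow> nat list set \<Rightarrow> nat \<Rightarrow> int_mpoly \<Rightarrow> bool" where
  "diophantine_representation n M m W \<longleftrightarrow>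
     mpoly_vars W \<subseteq> {..<n + m} \<and>
     (\<forall>as\<in>tuples n. as \<in> M \<longleftrightarrow> (\<exists>xs\<in>tuples m. mpoly_at W (as @ xs) = 0))"

definition finite_fold :: "nat \<Rightarrow> nat \<Rightarrow> int_mpoly \<Rightarrow> bool" where
  "finite_fold n m W \<longleftrightarrow>
     (\<forall>as\<in>tuples n. finite {xs \<in> tuples m. mpoly_at W (as @ xs) = 0})"

definition matiyasevich_conjecture :: bool where
  "matiyasevich_conjecture \<longleftrightarrow>
     (\<forall>n>0. \<forall>M. recursively_enumerable n M \<longrightarrow>
        (\<exists>m W. diophantine_representation n M m W \<and> finite_fold n m W))"

section \<open>Subsystems of \<open>E\<^sub>n\<close>\<close>

text \<open>The equations \<open>x\<^sub>i = 1\<close>, \<open>x\<^sub>i + x\<^sub>j = x\<^sub>k\<close> and \<open>x\<^sub>i \<cdot> x\<^sub>j = x\<^sub>k\<close>, as syntactic objects.\<close>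

datatype equation = One_eq nat | Add_eq nat nat nat | Mult_eq nat nat nat

definition E :: "nat \<Rightarrow> equation set" where
  "E n = {One_eq i | i. i \<in> {1..n}}
       \<union> {Add_eq i j k | i j k. i \<in> {1..n} \<and> j \<in> {1..n} \<and> k \<in> {1..n}}
       \<union> {Mult_eq i j k | i j k. i \<in> {1..n} \<and> j \<in> {1..n} \<and> k \<in> {1..n}}"

fun satisfies :: "(nat \<Rightarrow> int) \<Rightarrow> equation \<Rightarrow> bool" where
  "satisfies x (One_eq i) \<longleftrightarrow> x i = 1"
| "satisfies x (Add_eq i j k) \<longleftrightarrow> x i + x j = x k"
| "satisfies x (Mult_eq i j k) \<longleftrightarrow> x i * x j = x k"

text \<open>Integer tuples \<open>(x\<^sub>1, \<dots>, x\<^sub>n)\<close> are functions on \<open>{1..n}\<close>, made extensional so that distinct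
  functions are distinct tuples and the solutions can be counted.\<close>

definition int_solutions :: "nat \<Rightarrow> equation set \<Rightarrow> (nat \<Rightarrow> int) set" where
  "int_solutions n S = {x \<in> {1..n} \<rightarrow>\<^sub>E UNIV. \<forall>e\<in>S. satisfies x e}"

end

theory Submission
  imports Defs "HOL-Computational_Algebra.Primes"
begin

text \<open>The set \<open>{(n, y). y < f n}\<close> is recursively enumerable, so it has a finite-fold representation
  \<open>W\<close>; for fixed \<open>n\<close> the equation \<open>W = 0\<close> has finitely many solutions in natural numbers, and at
  least one for each of the \<open>f n\<close> values of \<open>y\<close>. Replacing each unknown by a sum of four integer
  squares keeps both properties over the integers, by Lagrange's theorem and because a natural number
  has finitely many such representations. Evaluating the resulting polynomial step by step takes a
  number \<open>N\<close> of variables that does not depend on \<open>n\<close>. For \<open>n \<ge> 2 * N\<close> the remaining \<open>n - N\<close>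
  variables count up to \<open>n - N\<close> and pass through \<open>N\<close>, so a single addition forces the parameter to
  be \<open>n\<close>.\<close>

section \<open>Lagrange's four squares theorem\<close>

definition four_squares :: "int \<Rightarrow> bool" where
  "four_squares n \<longleftrightarrow> (\<exists>a b c d. n = a\<^sup>2 + b\<^sup>2 + c\<^sup>2 + d\<^sup>2)"

text \<open>Multiplicativity of the quaternion norm. The four squares on the right belong, up to
  sign, to the components of one quaternion times the conjugate of the other; with the conjugate,
  arguments congruent modulo \<open>m\<close> make the last three components divisible by
  \<open>m\<close>, as the descent needs.\<close>

lemma euler_four_squares:
  fixes a b c d :: int
  shows "(a\<^sup>2 + b\<^sup>2 + c\<^sup>2 + d\<^sup>2) * (a'\<^sup>2 + b'\<^sup>2 + c'\<^sup>2 + d'\<^sup>2) =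
    (a * a' + b * b' + c * c' + d * d')\<^sup>2 + (a * b' - b * a' + c * d' - d * c')\<^sup>2 +
    (a * c' - c * a' + d * b' - b * d')\<^sup>2 + (a * d' - d * a' + b * c' - c * b')\<^sup>2"
  by (simp add: power2_eq_square algebra_simps)

lemma four_squares_mult:
  assumes "four_squares m" "four_squares n"
  shows "four_squares (m * n)"
  using assms unfolding four_squares_def by (metis euler_four_squares)

lemma least_absolute_residue:
  fixes x m :: int
  assumes "m > 0"
  obtains y where "m dvd x - y" "2 * \<bar>y\<bar> \<le> m"
proof
  \<comment> \<open>Shifting by \<open>m div 2\<close> before and after the reduction centres the
    remainders at 0.\<close>
  let ?y = "(x + m div 2) mod m - m div 2"
  have "x - ?y = m * ((x + m div 2) div m)"
    by (simp add: algebra_simps minus_mod_eq_mult_div[symmetric])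
  thus "m dvd x - ?y" by simp
  have "2 * \<bar>r - m div 2\<bar> \<le> m" if "0 \<le> r" "r < m" for r
    using that by presburger
  thus "2 * \<bar>?y\<bar> \<le> m" using assms by simp
qed

text \<open>The extreme case of the descent: with \<open>x = y + m * q\<close> and
  \<open>m = 2 * y\<close> or \<open>m = - 2 * y\<close>, the cross term
  \<open>2 * y * m * q\<close> is plus or minus \<open>m\<^sup>2 * q\<close>. Hence four such
  squares add up to a multiple of \<open>m\<^sup>2\<close>.\<close>

lemma square_of_half_residue:
  fixes x y m :: int
  assumes "m dvd x - y" "2 * \<bar>y\<bar> = m"
  obtains k where "4 * x\<^sup>2 = m\<^sup>2 + 4 * m\<^sup>2 * k"
proof -
  obtain q where q: "x = y + m * q" using assms(1) by (metis dvdE diff_add_cancel add.commute)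
  have "m = 2 * y \<or> m = - 2 * y" using assms(2) by linarith
  hence "4 * x\<^sup>2 = m\<^sup>2 + 4 * m\<^sup>2 * (q\<^sup>2 + q) \<or> 4 * x\<^sup>2 = m\<^sup>2 + 4 * m\<^sup>2 * (q\<^sup>2 - q)"
    unfolding q by (auto simp: power2_eq_square algebra_simps)
  thus thesis using that by blast
qed

text \<open>Lagrange's descent. The squares of the least absolute residues modulo \<open>m\<close>
  add up to \<open>m * r\<close> with \<open>r \<le> m\<close>, and Euler's identity writes
  \<open>m\<^sup>2 * r * p\<close> as four squares of multiples of \<open>m\<close>, so
  \<open>m\<^sup>2\<close> cancels.\<close>

lemma four_squares_descent:
  fixes m p :: int
  assumes p: "prime p" and m: "1 < m" "m < p" and sq: "four_squares (m * p)"
  obtains r where "0 < r" "r < m" "four_squares (r * p)"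
proof -
  from sq obtain a b c d where abcd: "m * p = a\<^sup>2 + b\<^sup>2 + c\<^sup>2 + d\<^sup>2"
    unfolding four_squares_def by blast
  have m0: "m > 0" using m by simp
  have ndvd: "\<not> m dvd p"
    using p m by (metis prime_int_iff less_irrefl order_less_trans zero_less_one less_imp_le)
  \<comment> \<open>The extreme values \<open>r = 0\<close> and \<open>r = m\<close> are both
    refuted through this: each makes \<open>m * p\<close> divisible by \<open>m\<^sup>2\<close>,
    hence \<open>p\<close> divisible by \<open>m\<close>.\<close>
  have nsq: False if "m\<^sup>2 dvd m * p"
    using that ndvd m0 by (simp add: power2_eq_square)
  obtain a' where a': "m dvd a - a'" "2 * \<bar>a'\<bar> \<le> m" using least_absolute_residue[OF m0] .
  obtain b' where b': "m dvd b - b'" "2 * \<bar>b'\<bar> \<le> m" using least_absolute_residue[OF m0] .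
  obtain c' where c': "m dvd c - c'" "2 * \<bar>c'\<bar> \<le> m" using least_absolute_residue[OF m0] .
  obtain d' where d': "m dvd d - d'" "2 * \<bar>d'\<bar> \<le> m" using least_absolute_residue[OF m0] .
  let ?s = "a'\<^sup>2 + b'\<^sup>2 + c'\<^sup>2 + d'\<^sup>2"
  obtain ka where ka: "a = a' + m * ka" using a'(1) by (metis dvdE diff_add_cancel add.commute)
  obtain kb where kb: "b = b' + m * kb" using b'(1) by (metis dvdE diff_add_cancel add.commute)
  obtain kc where kc: "c = c' + m * kc" using c'(1) by (metis dvdE diff_add_cancel add.commute)
  obtain kd where kd: "d = d' + m * kd" using d'(1) by (metis dvdE diff_add_cancel add.commute)
  have "?s = m * (p - (2 * (a' * ka + b' * kb + c' * kc + d' * kd)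
      + m * (ka\<^sup>2 + kb\<^sup>2 + kc\<^sup>2 + kd\<^sup>2)))"
    using abcd unfolding ka kb kc kd by (simp add: power2_eq_square algebra_simps)
  then obtain r where r: "?s = m * r" by blast
  have sq4: "4 * y\<^sup>2 \<le> m\<^sup>2" if "2 * \<bar>y\<bar> \<le> m" for y :: int
    using power_mono[OF that, of 2] by (simp add: power_mult_distrib)
  have sq4eq: "2 * \<bar>y\<bar> = m" if "4 * y\<^sup>2 = m\<^sup>2" for y :: int
  proof (rule power_eq_imp_eq_base[of _ 2])
    show "(2 * \<bar>y\<bar>)\<^sup>2 = m\<^sup>2" using that by (simp add: power_mult_distrib)
  qed (use m0 in auto)
  note bounds = sq4[OF a'(2)] sq4[OF b'(2)] sq4[OF c'(2)] sq4[OF d'(2)]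
  have "m * r \<le> m * m" using bounds r by (simp add: power2_eq_square)
  hence "r \<le> m" using m0 by simp
  have "m * r \<ge> 0" unfolding r[symmetric] by simp
  hence "r \<ge> 0" using m0 by (simp add: zero_le_mult_iff)
  have "r \<noteq> 0"
  proof
    assume "r = 0"
    hence s0: "?s = 0" using r by simp
    have "a'\<^sup>2 = 0" "b'\<^sup>2 = 0" "c'\<^sup>2 = 0" "d'\<^sup>2 = 0"
      using s0 zero_le_power2[of a'] zero_le_power2[of b'] zero_le_power2[of c']
        zero_le_power2[of d'] by linarith+
    hence "m * p = m\<^sup>2 * (ka\<^sup>2 + kb\<^sup>2 + kc\<^sup>2 + kd\<^sup>2)"
      using abcd unfolding ka kb kc kd by (simp add: power_mult_distrib algebra_simps)
    thus False using nsq by simp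
  qed
  moreover have "r \<noteq> m"
  proof
    assume "r = m"
    \<comment> \<open>The four bounds now add up to an equality, so each of them is one.\<close>
    hence "4 * a'\<^sup>2 = m\<^sup>2" "4 * b'\<^sup>2 = m\<^sup>2" "4 * c'\<^sup>2 = m\<^sup>2" "4 * d'\<^sup>2 = m\<^sup>2"
      using bounds r by (simp_all add: power2_eq_square)
    note h = this[THEN sq4eq]
    obtain qa qb qc qd where
      "4 * a\<^sup>2 = m\<^sup>2 + 4 * m\<^sup>2 * qa" "4 * b\<^sup>2 = m\<^sup>2 + 4 * m\<^sup>2 * qb"
      "4 * c\<^sup>2 = m\<^sup>2 + 4 * m\<^sup>2 * qc" "4 * d\<^sup>2 = m\<^sup>2 + 4 * m\<^sup>2 * qd"
      using square_of_half_residue[OF a'(1) h(1)] square_of_half_residue[OF b'(1) h(2)]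
        square_of_half_residue[OF c'(1) h(3)] square_of_half_residue[OF d'(1) h(4)] by metis
    hence "m * p = m\<^sup>2 * (1 + qa + qb + qc + qd)"
      using abcd by (simp add: algebra_simps)
    thus False using nsq by simp
  qed
  ultimately have "0 < r" "r < m" using \<open>r \<ge> 0\<close> \<open>r \<le> m\<close> by auto
  moreover have "four_squares (r * p)"
  proof -
    \<comment> \<open>The components in Euler's identity divided by \<open>m\<close>, after
      substituting \<open>a' = a - m * ka\<close> and so on; in the first, \<open>m * p\<close>
      replaces the sum of squares.\<close>
    let ?z1 = "p - (a * ka + b * kb + c * kc + d * kd)"
    let ?z2 = "b * ka - a * kb + d * kc - c * kd"
    let ?z3 = "c * ka - a * kc + b * kd - d * kb"
    let ?z4 = "d * ka - a * kd + c * kb - b * kc"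
    have e: "a' = a - m * ka" "b' = b - m * kb" "c' = c - m * kc" "d' = d - m * kd"
      using ka kb kc kd by auto
    have "a * a' + b * b' + c * c' + d * d' = m * ?z1"
      using abcd unfolding e by (simp add: power2_eq_square algebra_simps)
    moreover have "a * b' - b * a' + c * d' - d * c' = m * ?z2"
      "a * c' - c * a' + d * b' - b * d' = m * ?z3"
      "a * d' - d * a' + b * c' - c * b' = m * ?z4"
      unfolding e by (simp_all add: algebra_simps)
    ultimately have "(m * p) * (m * r) = (m * ?z1)\<^sup>2 + (m * ?z2)\<^sup>2 + (m * ?z3)\<^sup>2 + (m * ?z4)\<^sup>2"
      unfolding abcd r[symmetric] euler_four_squares by presburger
    also have "\<dots> = m\<^sup>2 * (?z1\<^sup>2 + ?z2\<^sup>2 + ?z3\<^sup>2 + ?z4\<^sup>2)"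
      by (simp only: power_mult_distrib distrib_left)
    finally have "m\<^sup>2 * (r * p) = m\<^sup>2 * (?z1\<^sup>2 + ?z2\<^sup>2 + ?z3\<^sup>2 + ?z4\<^sup>2)"
      by (simp only: power2_eq_square[of m] mult_ac)
    hence "r * p = ?z1\<^sup>2 + ?z2\<^sup>2 + ?z3\<^sup>2 + ?z4\<^sup>2" using m0 by simp
    thus ?thesis unfolding four_squares_def by blast
  qed
  ultimately show thesis using that by blast
qed

text \<open>If the squares agree, \<open>p\<close> divides \<open>a - b\<close> or
  \<open>a + b\<close>; on the lower half of the residues both are below \<open>p\<close> in
  absolute value, so one of them is 0.\<close>

lemma inj_on_square_mod_prime:
  fixes p :: int
  assumes "prime p"
  shows "inj_on (\<lambda>a. a\<^sup>2 mod p) {0..(p - 1) div 2}"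
proof (rule inj_onI)
  fix a b assume ab: "a \<in> {0..(p - 1) div 2}" "b \<in> {0..(p - 1) div 2}" "a\<^sup>2 mod p = b\<^sup>2 mod p"
  have "p dvd a\<^sup>2 - b\<^sup>2" using ab(3) by (simp add: mod_eq_dvd_iff)
  hence "p dvd (a - b) * (a + b)" by (simp add: power2_eq_square algebra_simps)
  hence "p dvd a - b \<or> p dvd a + b" using assms by (simp add: prime_dvd_mult_iff)
  moreover have "\<bar>a - b\<bar> < p" "a + b < p" "a + b \<ge> 0" using ab by auto
  ultimately have "a - b = 0 \<or> a + b = 0"
    using dvd_imp_le_int[of "a - b" p] dvd_imp_le_int[of "a + b" p] by auto
  thus "a = b" using ab(1,2) by auto
qed

text \<open>Pigeonhole: over the lower half, \<open>a\<^sup>2\<close> and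
  \<open>- 1 - b\<^sup>2\<close> take \<open>(p + 1) div 2\<close> residues each, together more than
  \<open>p\<close>, so some residue is of both forms.\<close>

lemma prime_dvd_one_plus_two_squares:
  fixes p :: int
  assumes "prime p" "odd p"
  obtains a b where "p dvd 1 + a\<^sup>2 + b\<^sup>2" "0 \<le> a" "2 * a < p" "0 \<le> b" "2 * b < p"
proof -
  have p: "p > 1" using assms prime_gt_1_int by blast
  let ?H = "{0..(p - 1) div 2}"
  let ?f = "\<lambda>a. a\<^sup>2 mod p" and ?g = "\<lambda>b. (- 1 - b\<^sup>2) mod p"
  have f: "inj_on ?f ?H" using assms(1) by (rule inj_on_square_mod_prime)
  have "inj_on ?g ?H"
  proof (rule inj_onI)
    fix a b assume ab: "a \<in> ?H" "b \<in> ?H" "?g a = ?g b"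
    hence "p dvd (- 1 - a\<^sup>2) - (- 1 - b\<^sup>2)" by (simp only: mod_eq_dvd_iff)
    hence "p dvd b\<^sup>2 - a\<^sup>2" by simp
    hence "?f b = ?f a" by (simp only: mod_eq_dvd_iff)
    thus "a = b" using f ab by (auto dest: inj_onD)
  qed
  hence cards: "card (?f ` ?H) = nat ((p + 1) div 2)" "card (?g ` ?H) = nat ((p + 1) div 2)"
    using f p by (auto simp: card_image)
  have "?f ` ?H \<inter> ?g ` ?H \<noteq> {}"
  proof
    assume "?f ` ?H \<inter> ?g ` ?H = {}"
    hence "card (?f ` ?H \<union> ?g ` ?H) = 2 * nat ((p + 1) div 2)"
      using cards by (simp add: card_Un_disjoint)
    moreover have "card (?f ` ?H \<union> ?g ` ?H) \<le> card {0..<p}"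
      by (rule card_mono) (use p in auto)
    ultimately show False using p assms(2) by (auto elim!: oddE)
  qed
  then obtain a b where ab: "a \<in> ?H" "b \<in> ?H" "?f a = ?g b" by blast
  have "p dvd a\<^sup>2 - (- 1 - b\<^sup>2)" using ab(3) by (simp only: mod_eq_dvd_iff)
  hence "p dvd 1 + a\<^sup>2 + b\<^sup>2" by (simp add: algebra_simps)
  thus thesis using that ab by auto
qed

text \<open>For odd \<open>p\<close> the multiple \<open>1 + a\<^sup>2 + b\<^sup>2\<close> of
  \<open>p\<close> is a sum of four squares, one of them 0; descent lowers its cofactor to
  1.\<close>

lemma four_squares_prime:
  fixes p :: int
  assumes "prime p"
  shows "four_squares p"
proof (cases "even p")
  case True
  hence "p = 2" using primes_dvd_imp_eq[OF two_is_prime assms] by simp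
  thus ?thesis unfolding four_squares_def
    by (intro exI[of _ 1] exI[of _ 1] exI[of _ 0]) simp
next
  case False
  have p: "p > 1" using assms prime_gt_1_int by blast
  obtain a b where ab: "p dvd 1 + a\<^sup>2 + b\<^sup>2" "0 \<le> a" "2 * a < p" "0 \<le> b" "2 * b < p"
    using prime_dvd_one_plus_two_squares[OF assms False] .
  obtain m where m: "1 + a\<^sup>2 + b\<^sup>2 = m * p" using ab(1) by (metis dvdE mult.commute)
  \<comment> \<open>The smallness of \<open>a\<close> and \<open>b\<close> is what brings the
    cofactor \<open>m\<close> below \<open>p\<close>, where descent applies.\<close>
  have sq: "4 * y\<^sup>2 \<le> (p - 1)\<^sup>2" if "0 \<le> y" "2 * y < p" for y
    using power_mono[of "2 * y" "p - 1" 2] that by (simp add: power_mult_distrib)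
  have "2 * (m * p) \<le> 2 + (p - 1)\<^sup>2" using sq[OF ab(2,3)] sq[OF ab(4,5)] m by simp
  also have "\<dots> < 2 * p\<^sup>2" using p mult_strict_mono[of 1 p 1 p] by (simp add: power2_eq_square algebra_simps)
  finally have "m < p" using p by (simp add: power2_eq_square)
  have "m * p > 0" using m zero_le_power2[of a] zero_le_power2[of b] by linarith
  hence "m > 0" using p by (simp add: zero_less_mult_iff)
  have "four_squares (m * p)"
    unfolding four_squares_def m[symmetric]
    by (intro exI[of _ 1] exI[of _ a] exI[of _ b] exI[of _ 0]) simp
  with \<open>0 < m\<close> \<open>m < p\<close> show ?thesis
  proof (induction "nat m" arbitrary: m rule: less_induct)
    case less
    show ?case
    proof (cases "m = 1")
      case True
      thus ?thesis using less.prems by simp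
    next
      case False
      with less.prems obtain r where r: "0 < r" "r < m" "four_squares (r * p)"
        using four_squares_descent[OF assms, of m] by (metis int_one_le_iff_zero_less le_less)
      thus ?thesis using less.hyps[of r] less.prems by simp
    qed
  qed
qed

lemma four_squares_nat: "four_squares (int n)"
proof (induction n rule: prime_divisors_induct)
  case zero
  show ?case unfolding four_squares_def by (intro exI[of _ 0]) simp
next
  case (unit n)
  thus ?case unfolding four_squares_def
    by (intro exI[of _ 1] exI[of _ 0]) simp
next
  case (factor p n)
  thus ?case using four_squares_mult[of "int p" "int n"] four_squares_prime[of "int p"] by simp
qed

section \<open>Polynomials and systems of equations\<close>

lemma satisfies_cong:
  assumes "e \<in> E N" "\<And>i. i \<in> {1..N} \<Longrightarrow> x i = y i"
  shows "satisfies x e \<longleftrightarrow> satisfies y e"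
  using assms by (auto simp: E_def)

lemma equation_in_E [simp]:
  "One_eq i \<in> E N \<longleftrightarrow> i \<in> {1..N}"
  "Add_eq i j k \<in> E N \<longleftrightarrow> {i, j, k} \<subseteq> {1..N}"
  "Mult_eq i j k \<in> E N \<longleftrightarrow> {i, j, k} \<subseteq> {1..N}"
  by (auto simp: E_def)

lemma E_mono: "N \<le> N' \<Longrightarrow> E N \<subseteq> E N'"
  unfolding E_def by fastforce

lemma restrict_int_solutions:
  assumes "S \<subseteq> E N" "S \<subseteq> S'" "x \<in> int_solutions N' S'"
  shows "restrict x {1..N} \<in> int_solutions N S"
proof -
  have "satisfies (restrict x {1..N}) e" if "e \<in> S" for e
    using satisfies_cong[of e N x "restrict x {1..N}"] that assms by (auto simp: int_solutions_def)
  thus ?thesis by (auto simp: int_solutions_def)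
qed

text \<open>An equation that fixes the new variable, whatever the others are, extends each solution
  in exactly one way. Adding such equations evaluates an expression without changing the number of
  solutions.\<close>

lemma bij_betw_restrict_int_solutions:
  assumes S: "S \<subseteq> E N"
    and e: "\<And>x. \<exists>!v. satisfies (x(Suc N := v)) e"
  shows "bij_betw (\<lambda>x. restrict x {1..N}) (int_solutions (Suc N) (insert e S)) (int_solutions N S)"
  unfolding bij_betw_def
proof
  let ?r = "\<lambda>x::nat \<Rightarrow> int. restrict x {1..N}"
  show "inj_on ?r (int_solutions (Suc N) (insert e S))"
  proof (rule inj_onI)
    fix x y
    assume xy: "x \<in> int_solutions (Suc N) (insert e S)" "y \<in> int_solutions (Suc N) (insert e S)"
      "?r x = ?r y"
    have eq: "x i = y i" if "i \<noteq> Suc N" for i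
    proof (cases "i \<in> {1..N}")
      case True
      thus ?thesis using xy(3) by (metis restrict_apply')
    next
      case False
      hence "i \<notin> {1..Suc N}" using that by auto
      thus ?thesis using xy(1,2) by (auto simp: int_solutions_def PiE_def extensional_def)
    qed
    hence "y = x(Suc N := y (Suc N))" by auto
    moreover have "satisfies x e" "satisfies y e" using xy by (auto simp: int_solutions_def)
    ultimately show "x = y" using e[of x] by (metis fun_upd_triv)
  qed
  show "?r ` int_solutions (Suc N) (insert e S) = int_solutions N S"
  proof
    show "?r ` int_solutions (Suc N) (insert e S) \<subseteq> int_solutions N S"
      using restrict_int_solutions[OF S, of "insert e S"] by auto
    show "int_solutions N S \<subseteq> ?r ` int_solutions (Suc N) (insert e S)"
    proof
      fix x assume x: "x \<in> int_solutions N S"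
      obtain v where v: "satisfies (x(Suc N := v)) e" using e by blast
      let ?y = "x(Suc N := v)"
      have "satisfies ?y e'" if "e' \<in> S" for e'
        using satisfies_cong[of e' N x ?y] that S x by (auto simp: int_solutions_def)
      hence "?y \<in> int_solutions (Suc N) (insert e S)"
        using x v by (auto simp: int_solutions_def PiE_def extensional_def)
      moreover have "?r ?y = x"
        using x by (auto simp: int_solutions_def PiE_def extensional_def fun_eq_iff)
      ultimately show "x \<in> ?r ` int_solutions (Suc N) (insert e S)" by (metis (no_types, lifting) image_eqI)
    qed
  qed
qed

text \<open>The first \<open>D\<close> variables are the arguments of \<open>F\<close>. Allowing an arbitrary initial system \<open>S\<close>
  is what makes definable functions composable, and the bijection keeps the count of solutions.\<close>

definition definable :: "nat \<Rightarrow> ((nat \<Rightarrow> int) \<Rightarrow> int) \<Rightarrow> bool" where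
  "definable D F \<longleftrightarrow> (\<forall>N S. D \<le> N \<longrightarrow> S \<subseteq> E N \<longrightarrow>
     (\<exists>N' S' k. N \<le> N' \<and> S \<subseteq> S' \<and> S' \<subseteq> E N' \<and> k \<in> {1..N'} \<and>
        bij_betw (\<lambda>x. restrict x {1..N}) (int_solutions N' S') (int_solutions N S) \<and>
        (\<forall>x\<in>int_solutions N' S'. x k = F (restrict x {1..D}))))"

lemma definableE:
  assumes "definable D F" "D \<le> N" "S \<subseteq> E N"
  obtains N' S' k where "N \<le> N'" "S \<subseteq> S'" "S' \<subseteq> E N'" "k \<in> {1..N'}"
    "bij_betw (\<lambda>x. restrict x {1..N}) (int_solutions N' S') (int_solutions N S)"
    "\<forall>x\<in>int_solutions N' S'. x k = F (restrict x {1..D})"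
  using assms unfolding definable_def by metis

section \<open>Closure of definable functions under polynomial operations\<close>

lemma definable_var:
  assumes "i \<in> {1..D}"
  shows "definable D (\<lambda>x. x i)"
  unfolding definable_def
proof (intro allI impI)
  fix N S assume h: "D \<le> N" "S \<subseteq> E N"
  have "restrict x {1..N} = x" if "x \<in> int_solutions N S" for x
    using that PiE_restrict unfolding int_solutions_def by blast
  hence "bij_betw (\<lambda>x. restrict x {1..N}) (int_solutions N S) (int_solutions N S)"
    using bij_betw_cong[of "int_solutions N S" "\<lambda>x. restrict x {1..N}" id] by simp
  thus "\<exists>N' S' k. N \<le> N' \<and> S \<subseteq> S' \<and> S' \<subseteq> E N' \<and> k \<in> {1..N'} \<and>
        bij_betw (\<lambda>x. restrict x {1..N}) (int_solutions N' S') (int_solutions N S) \<and>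
        (\<forall>x\<in>int_solutions N' S'. x k = restrict x {1..D} i)"
    using h assms by (intro exI[of _ N] exI[of _ S] exI[of _ i]) auto
qed

lemma definable_one: "definable D (\<lambda>x. 1)"
  unfolding definable_def
proof (intro allI impI)
  fix N S assume h: "D \<le> N" "S \<subseteq> E N"
  let ?S = "insert (One_eq (Suc N)) S"
  have "bij_betw (\<lambda>x. restrict x {1..N}) (int_solutions (Suc N) ?S) (int_solutions N S)"
    by (rule bij_betw_restrict_int_solutions[OF h(2)]) auto
  moreover have "?S \<subseteq> E (Suc N)"
    using h(2) E_mono[of N "Suc N"] by auto
  ultimately show "\<exists>N' S' k. N \<le> N' \<and> S \<subseteq> S' \<and> S' \<subseteq> E N' \<and> k \<in> {1..N'} \<and>
        bij_betw (\<lambda>x. restrict x {1..N}) (int_solutions N' S') (int_solutions N S) \<and>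
        (\<forall>x\<in>int_solutions N' S'. x k = 1)"
    by (intro exI[of _ "Suc N"] exI[of _ ?S] exI[of _ "Suc N"]) (auto simp: int_solutions_def)
qed

text \<open>The system for \<open>G\<close> is built on top of the one for \<open>F\<close>, and one
  more equation computes \<open>h\<close> in a fresh variable; the bijection is the composite of
  three restrictions. Keeping \<open>eq\<close> and \<open>h\<close> abstract lets one proof serve
  products, differences and sums.\<close>

lemma definable_binop:
  assumes F: "definable D F" and G: "definable D G"
    and eq: "\<And>x i j k. satisfies x (eq i j k) \<longleftrightarrow> x k = h (x i) (x j)"
    and eq_E: "\<And>i j k N. {i, j, k} \<subseteq> {1..N} \<Longrightarrow> eq i j k \<in> E N"
  shows "definable D (\<lambda>x. h (F x) (G x))"
  unfolding definable_def
proof (intro allI impI)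
  fix N S assume h: "D \<le> N" "S \<subseteq> E N"
  obtain N1 S1 i where 1: "N \<le> N1" "S \<subseteq> S1" "S1 \<subseteq> E N1" "i \<in> {1..N1}"
    "bij_betw (\<lambda>x. restrict x {1..N}) (int_solutions N1 S1) (int_solutions N S)"
    "\<forall>x\<in>int_solutions N1 S1. x i = F (restrict x {1..D})"
    by (rule definableE[OF F h]) (rule that)
  have "D \<le> N1" using h 1 by simp
  obtain N2 S2 j where 2: "N1 \<le> N2" "S1 \<subseteq> S2" "S2 \<subseteq> E N2" "j \<in> {1..N2}"
    "bij_betw (\<lambda>x. restrict x {1..N1}) (int_solutions N2 S2) (int_solutions N1 S1)"
    "\<forall>x\<in>int_solutions N2 S2. x j = G (restrict x {1..D})"
    by (rule definableE[OF G \<open>D \<le> N1\<close> 1(3)]) (rule that)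
  let ?e = "eq i j (Suc N2)"
  let ?S = "insert ?e S2"
  have ij: "i \<noteq> Suc N2" "j \<noteq> Suc N2" using 1 2 by auto
  have 3: "bij_betw (\<lambda>x. restrict x {1..N2}) (int_solutions (Suc N2) ?S) (int_solutions N2 S2)"
    by (rule bij_betw_restrict_int_solutions[OF 2(3)]) (use ij in \<open>auto simp: eq\<close>)
  have r: "restrict (restrict x {1..a}) {1..b} = restrict x {1..b}" if "b \<le> a"
    for a b and x :: "nat \<Rightarrow> int"
    using that by (auto simp: fun_eq_iff restrict_def)
  have "(\<lambda>x. restrict x {1..N}) \<circ> (\<lambda>x. restrict x {1..N1}) \<circ> (\<lambda>x. restrict x {1..N2}) =
      (\<lambda>x::nat \<Rightarrow> int. restrict x {1..N})"
    using 1(1) 2(1) by (simp add: o_def r)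
  hence "bij_betw (\<lambda>x. restrict x {1..N}) (int_solutions (Suc N2) ?S) (int_solutions N S)"
    using bij_betw_trans[OF bij_betw_trans[OF 3 2(5)] 1(5)] by (simp add: comp_assoc)
  moreover have "?S \<subseteq> E (Suc N2)"
    using 1 2 E_mono[of N2 "Suc N2"] eq_E[of i j "Suc N2" "Suc N2"] by auto
  moreover have "x (Suc N2) = h (F (restrict x {1..D})) (G (restrict x {1..D}))"
    if x: "x \<in> int_solutions (Suc N2) ?S" for x
  proof -
    \<comment> \<open>The values of \<open>F\<close> and \<open>G\<close> are known only on
      solutions of the smaller systems, so \<open>x\<close> is cut down to these; its first
      \<open>D\<close> entries survive.\<close>
    let ?y = "restrict x {1..N2}" and ?z = "restrict x {1..N1}"
    have "?y \<in> int_solutions N2 S2" using restrict_int_solutions[OF 2(3) _ x] by blast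
    hence "?y j = G (restrict x {1..D})" using 2(6) \<open>D \<le> N1\<close> 2(1) by (metis r order.trans)
    moreover have "?z \<in> int_solutions N1 S1" using restrict_int_solutions[OF 1(3) _ x] 2(2) by blast
    hence "?z i = F (restrict x {1..D})" using 1(6) \<open>D \<le> N1\<close> by (metis r)
    moreover have "?y j = x j" "?z i = x i" using 1 2 by auto
    moreover have "x (Suc N2) = h (x i) (x j)" using x by (simp add: int_solutions_def eq)
    ultimately show ?thesis by simp
  qed
  ultimately show "\<exists>N' S' k. N \<le> N' \<and> S \<subseteq> S' \<and> S' \<subseteq> E N' \<and> k \<in> {1..N'} \<and>
        bij_betw (\<lambda>x. restrict x {1..N}) (int_solutions N' S') (int_solutions N S) \<and>
        (\<forall>x\<in>int_solutions N' S'. x k = h (F (restrict x {1..D})) (G (restrict x {1..D})))"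
    using 1(1,2) 2(1,2) by (intro exI[of _ "Suc N2"] exI[of _ ?S] exI[of _ "Suc N2"]) auto
qed

lemma definable_mult: "definable D F \<Longrightarrow> definable D G \<Longrightarrow> definable D (\<lambda>x. F x * G x)"
  by (rule definable_binop[where eq = Mult_eq]) auto

text \<open>\<open>Add_eq j k i\<close>, with its last two indices exchanged in role, determines the
  fresh variable \<open>k\<close> as a difference. This supplies 0 and the negative
  constants.\<close>

lemma definable_diff: "definable D F \<Longrightarrow> definable D G \<Longrightarrow> definable D (\<lambda>x. F x - G x)"
  by (rule definable_binop[where eq = "\<lambda>i j k. Add_eq j k i"]) auto

lemma definable_add: "definable D F \<Longrightarrow> definable D G \<Longrightarrow> definable D (\<lambda>x. F x + G x)"
  by (rule definable_binop[where eq = Add_eq]) auto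

lemma definable_zero: "definable D (\<lambda>x. 0)"
  using definable_diff[OF definable_one definable_one] by simp

lemma definable_const: "definable D (\<lambda>x. c)"
proof (induction c rule: int_induct[of _ 0])
  case (step1 i)
  thus ?case using definable_add[OF _ definable_one] by blast
next
  case (step2 i)
  thus ?case using definable_diff[OF _ definable_one] by blast
qed (rule definable_zero)

lemma definable_power: "definable D F \<Longrightarrow> definable D (\<lambda>x. F x ^ n)"
  by (induction n) (auto intro: definable_one definable_mult)

lemma definable_sum:
  "(\<And>i. i \<in> A \<Longrightarrow> definable D (F i)) \<Longrightarrow> definable D (\<lambda>x. \<Sum>i\<in>A. F i x)"
  by (induction A rule: infinite_finite_induct) (auto intro: definable_zero definable_add)

lemma definable_prod:
  "(\<And>i. i \<in> A \<Longrightarrow> definable D (F i)) \<Longrightarrow> definable D (\<lambda>x. \<Prod>i\<in>A. F i x)"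
  by (induction A rule: infinite_finite_induct) (auto intro: definable_one definable_mult)

lemma definable_mpoly_eval:
  assumes "\<And>i. i \<in> mpoly_vars W \<Longrightarrow> definable D (\<lambda>x. v x i)"
  shows "definable D (\<lambda>x. mpoly_eval W (v x))"
  unfolding mpoly_eval_def
  by (intro definable_sum definable_mult definable_const definable_prod definable_power assms)
    (auto simp: mpoly_vars_def)

text \<open>Evaluation starts from the empty system, whose solutions are all
  \<open>D\<close>-tuples; one last equation then selects the zeros.\<close>

lemma definable_zeros:
  assumes "definable D F"
  obtains N S where "D \<le> N" "S \<subseteq> E N"
    "bij_betw (\<lambda>x. restrict x {1..D}) (int_solutions N S) {x \<in> {1..D} \<rightarrow>\<^sub>E UNIV. F x = 0}"
proof -
  obtain N S k where S: "D \<le> N" "S \<subseteq> E N" "k \<in> {1..N}"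
    "bij_betw (\<lambda>x. restrict x {1..D}) (int_solutions N S) (int_solutions D {})"
    "\<forall>x\<in>int_solutions N S. x k = F (restrict x {1..D})"
    by (rule definableE[OF assms order_refl empty_subsetI]) (rule that)
  \<comment> \<open>\<open>x k + x k = x k\<close> expresses \<open>x k = 0\<close>.\<close>
  let ?S = "insert (Add_eq k k k) S"
  have 1: "int_solutions N ?S = {x \<in> int_solutions N S. F (restrict x {1..D}) = 0}"
    using S(5) by (auto simp: int_solutions_def)
  have "bij_betw (\<lambda>x. restrict x {1..D}) (int_solutions N ?S) {x \<in> int_solutions D {}. F x = 0}"
    unfolding 1 using S(4) unfolding bij_betw_def by (auto simp: inj_on_def)
  moreover have "?S \<subseteq> E N" using S(2,3) by auto
  moreover have "int_solutions D {} = {1..D} \<rightarrow>\<^sub>E UNIV" by (simp add: int_solutions_def)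
  ultimately show thesis using that[of N ?S] S(1) by simp
qed

text \<open>The variables beyond \<open>N\<close> count \<open>1, 2, \<dots>, n - N\<close>, and the last equation then reads
  \<open>x\<^sub>t = (n - N) + N\<close>.\<close>

definition counting_system :: "nat \<Rightarrow> nat \<Rightarrow> nat \<Rightarrow> equation set" where
  "counting_system N t n =
     {One_eq (Suc N), Add_eq n (2 * N) t} \<union>
     {Add_eq j (Suc N) (Suc j) | j. N < j \<and> j < n}"

text \<open>The counting variables have forced values, so they do not change the number of
  solutions. The hypotheses \<open>0 < N\<close> and \<open>2 * N \<le> n\<close> make
  \<open>2 * N\<close> the index of a counting variable, and its value is \<open>N\<close>.\<close>

lemma counting_system:
  assumes N: "0 < N" "2 * N \<le> n" and t: "t \<in> {1..N}" and S: "S \<subseteq> E N"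
  shows "counting_system N t n \<union> S \<subseteq> E n"
    and "bij_betw (\<lambda>x. restrict x {1..N}) (int_solutions n (counting_system N t n \<union> S))
      {x \<in> int_solutions N S. x t = int n}"
proof -
  let ?C = "counting_system N t n"
  let ?r = "\<lambda>x::nat \<Rightarrow> int. restrict x {1..N}"
  have "?C \<subseteq> E n" using N t by (auto simp: counting_system_def)
  thus "?C \<union> S \<subseteq> E n" using E_mono[of N n] N S by auto
  have C: "x j = int j - int N" if x: "x \<in> int_solutions n (?C \<union> S)" and j: "N < j" "j \<le> n" for x j
  proof -
    from x have *: "satisfies x e" if "e \<in> ?C" for e using that by (auto simp: int_solutions_def)
    have "Suc N \<le> j" using j by simp
    thus ?thesis using j(2)
    proof (induction j rule: dec_induct)
      case base
      thus ?case using *[of "One_eq (Suc N)"] by (simp add: counting_system_def)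
    next
      case (step j)
      have "Add_eq j (Suc N) (Suc j) \<in> ?C" using step by (auto simp: counting_system_def)
      moreover have "One_eq (Suc N) \<in> ?C" by (simp add: counting_system_def)
      ultimately show ?case using *[of "Add_eq j (Suc N) (Suc j)"] *[of "One_eq (Suc N)"] step by simp
    qed
  qed
  show "bij_betw ?r (int_solutions n (?C \<union> S)) {x \<in> int_solutions N S. x t = int n}"
    unfolding bij_betw_def
  proof
    show "inj_on ?r (int_solutions n (?C \<union> S))"
    proof (rule inj_onI)
      fix x y assume xy: "x \<in> int_solutions n (?C \<union> S)" "y \<in> int_solutions n (?C \<union> S)" "?r x = ?r y"
      show "x = y"
      proof (rule PiE_ext[where k = "{1..n}" and s = "\<lambda>_. UNIV"])
        fix i assume "i \<in> {1..n}"
        then consider "i \<in> {1..N}" | "N < i" "i \<le> n" by fastforce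
        thus "x i = y i"
        proof cases
          case 1
          thus ?thesis using xy(3) by (metis restrict_apply')
        next
          case 2
          thus ?thesis using C[OF xy(1)] C[OF xy(2)] by simp
        qed
      qed (use xy in \<open>auto simp: int_solutions_def\<close>)
    qed
    show "?r ` int_solutions n (?C \<union> S) = {x \<in> int_solutions N S. x t = int n}" (is "?A = ?B")
    proof
      show "?A \<subseteq> ?B"
      proof
        fix y assume "y \<in> ?A"
        then obtain x where x: "x \<in> int_solutions n (?C \<union> S)" "y = ?r x" by blast
        hence "satisfies x (Add_eq n (2 * N) t)" by (auto simp: int_solutions_def counting_system_def)
        hence "x t = int n" using C[OF x(1), of n] C[OF x(1), of "2 * N"] N by simp
        thus "y \<in> ?B" using x t restrict_int_solutions[OF S _ x(1)] by auto
      qed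
      show "?B \<subseteq> ?A"
      proof
        fix x assume x: "x \<in> ?B"
        \<comment> \<open>The forced counter values extend \<open>x\<close>;
          \<open>undefined\<close> beyond \<open>n\<close> makes the tuple extensional.\<close>
        let ?y = "\<lambda>i. if i \<in> {1..N} then x i else if i \<in> {1..n} then int i - int N else undefined"
        have "satisfies ?y e" if "e \<in> S" for e
          using satisfies_cong[of e N x ?y] that S x by (auto simp: int_solutions_def)
        moreover have "satisfies ?y e" if "e \<in> ?C" for e
          using that N t x by (auto simp: counting_system_def)
        ultimately have "?y \<in> int_solutions n (?C \<union> S)"
          using N by (auto simp: int_solutions_def)
        moreover have "?r ?y = x"
          using x by (auto simp: int_solutions_def PiE_def extensional_def fun_eq_iff)
        ultimately show "x \<in> ?A" by (metis (no_types, lifting) image_eqI)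
      qed
    qed
  qed
qed

section \<open>Partial recursive functions\<close>

lemma evals_Zero_iff: "evals Zero xs y \<longleftrightarrow> y = 0"
  by (subst evals.simps) auto

lemma evals_Succ_iff: "evals Succ xs y \<longleftrightarrow> (\<exists>x. xs = [x] \<and> y = Suc x)"
  by (subst evals.simps) auto

lemma evals_Proj_iff: "evals (Proj i) xs y \<longleftrightarrow> i < length xs \<and> y = xs ! i"
  by (subst evals.simps) auto

lemma evals_Comp_iff:
  "evals (Comp f gs) xs z \<longleftrightarrow> (\<exists>ys. list_all2 (\<lambda>g. evals g xs) gs ys \<and> evals f ys z)"
  by (subst evals.simps) (auto simp: list_all2_conv_all_nth eq_commute[of "length gs"])

lemma evals_PrimRec_0_iff: "evals (PrimRec f g) (0 # xs) y \<longleftrightarrow> evals f xs y"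
  by (subst evals.simps) auto

lemma evals_PrimRec_Suc_iff:
  "evals (PrimRec f g) (Suc k # xs) z \<longleftrightarrow>
     (\<exists>y. evals (PrimRec f g) (k # xs) y \<and> evals g (k # y # xs) z)"
  by (subst evals.simps) auto

lemma evals_Mu_iff:
  "evals (Mu f) xs k \<longleftrightarrow> evals f (k # xs) 0 \<and> (\<forall>j<k. \<exists>y. evals f (j # xs) (Suc y))"
  by (subst evals.simps) auto

lemmas evals_iffs = evals_Zero_iff evals_Succ_iff evals_Proj_iff evals_Comp_iff
  evals_PrimRec_0_iff evals_PrimRec_Suc_iff evals_Mu_iff

section \<open>Recursive enumerability of the pairs with \<open>y < f n\<close>\<close>

definition pred_recf :: recf where
  "pred_recf = PrimRec Zero (Proj 0)"

text \<open>Recursion runs over the first argument, so the subtrahend comes first;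
  \<open>Proj 1\<close> picks the previous value, which is then decremented.\<close>

definition monus_recf :: recf where
  "monus_recf = PrimRec (Proj 0) (Comp pred_recf [Proj 1])"

lemma evals_pred_recf: "evals pred_recf [n] y \<longleftrightarrow> y = n - 1"
  unfolding pred_recf_def by (induction n arbitrary: y) (auto simp: evals_iffs)

lemma evals_monus_recf: "evals monus_recf [k, a] y \<longleftrightarrow> y = a - k"
  unfolding monus_recf_def
  by (induction k arbitrary: y) (auto simp: evals_iffs list_all2_Cons1 evals_pred_recf)

lemma arity_monus_recf: "arity 2 monus_recf"
proof -
  have "arity 1 pred_recf"
    unfolding pred_recf_def One_nat_def by (intro arity.intros) auto
  hence "arity 3 (Comp pred_recf [Proj 1])"
    by (intro arity_Comp) (simp_all add: arity_Proj)
  hence "arity (Suc (Suc 1)) (Comp pred_recf [Proj 1])" by (simp add: numeral_3_eq_3)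
  moreover have "arity 1 (Proj 0)" by (simp add: arity_Proj)
  ultimately have "arity (Suc 1) monus_recf" unfolding monus_recf_def by (intro arity_PrimRec)
  thus ?thesis by (simp add: numeral_2_eq_2)
qed

text \<open>The function under \<open>Mu\<close> ignores the search variable and computes
  \<open>Suc y - f n\<close>. The search stops at once if this is 0, that is if
  \<open>y < f n\<close>, and never otherwise.\<close>

lemma recursively_enumerable_less_computable:
  assumes "computable f"
  shows "recursively_enumerable 2 {[n, y] | n y. y < f n}"
proof -
  obtain r where r: "arity 1 r" "\<And>x y. evals r [x] y \<longleftrightarrow> y = f x"
    using assms unfolding computable_def by blast
  let ?h = "Comp monus_recf [Comp r [Proj 1], Comp Succ [Proj 2]]"
  have "arity 3 ?h"
    using r(1) arity_monus_recf arity_Succ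
    by (simp add: arity_Comp arity_Proj numeral_2_eq_2[symmetric])
  hence "arity 2 (Mu ?h)" by (intro arity_Mu) (simp add: numeral_eq_Suc)
  moreover have "xs \<in> {[n, y] | n y. y < f n} \<longleftrightarrow> (\<exists>k. evals (Mu ?h) xs k)"
    if "xs \<in> tuples 2" for xs
  proof -
    from that obtain n y where xs: "xs = [n, y]"
      by (auto simp: tuples_def length_Suc_conv numeral_2_eq_2)
    have "evals ?h [k, n, y] z \<longleftrightarrow> z = Suc y - f n" for k z
      by (auto simp: evals_iffs list_all2_Cons1 r(2) evals_monus_recf)
    hence "(\<exists>k. evals (Mu ?h) [n, y] k) \<longleftrightarrow> Suc y - f n = 0"
      by (auto simp: evals_Mu_iff intro: exI[of _ 0])
    thus ?thesis
      unfolding xs by auto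
  qed
  moreover have "{[n, y] | n y. y < f n} \<subseteq> tuples 2" by (auto simp: tuples_def)
  ultimately show ?thesis unfolding recursively_enumerable_def by blast
qed

section \<open>Finite-fold representations over the integers\<close>

lemma mpoly_eval_cong:
  assumes "\<And>i. i \<in> mpoly_vars W \<Longrightarrow> v i = w i"
  shows "mpoly_eval W v = mpoly_eval W w"
  unfolding mpoly_eval_def
proof (intro sum.cong refl arg_cong2[where f = "(*)"] prod.cong)
  fix m i assume "m \<in> Poly_Mapping.keys W" "i \<in> Poly_Mapping.keys m"
  thus "v i ^ Poly_Mapping.lookup m i = w i ^ Poly_Mapping.lookup m i"
    using assms[of i] unfolding mpoly_vars_def by fastforce
qed

text \<open>Integer variable \<open>1\<close> stands for the parameter (variable \<open>0\<close> of a representation), and each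
  block of four integer variables stands for one further natural number.\<close>

definition square_coords :: "(nat \<Rightarrow> int) \<Rightarrow> nat \<Rightarrow> int" where
  "square_coords x i = (if i = 0 then x 1
     else (x (4 * i - 2))\<^sup>2 + (x (4 * i - 1))\<^sup>2 + (x (4 * i))\<^sup>2 + (x (4 * i + 1))\<^sup>2)"

text \<open>The count \<open>4 * m + 5\<close> is one variable for the parameter and four for each
  of \<open>y\<close> and the \<open>m\<close> unknowns.\<close>

definition parameter_zeros :: "nat \<Rightarrow> int_mpoly \<Rightarrow> nat \<Rightarrow> (nat \<Rightarrow> int) set" where
  "parameter_zeros m W n =
     {x \<in> {1..4 * m + 5} \<rightarrow>\<^sub>E UNIV. mpoly_eval W (square_coords x) = 0 \<and> x 1 = int n}"

text \<open>Lagrange's theorem enters here: every tuple of natural numbers lifts to integer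
  variables.\<close>

lemma square_coords_surj:
  assumes "length zs = m + 2"
  obtains x where "x \<in> {1..4 * m + 5} \<rightarrow>\<^sub>E UNIV" "x 1 = int (zs ! 0)"
    "\<And>i. i < m + 2 \<Longrightarrow> square_coords x i = int (zs ! i)"
proof -
  have "\<exists>q :: nat \<Rightarrow> int. int z = (q 0)\<^sup>2 + (q 1)\<^sup>2 + (q 2)\<^sup>2 + (q 3)\<^sup>2" for z
  proof -
    obtain a b c d where "int z = a\<^sup>2 + b\<^sup>2 + c\<^sup>2 + d\<^sup>2"
      using four_squares_nat[of z] unfolding four_squares_def by blast
    thus ?thesis by (intro exI[of _ "\<lambda>i. [a, b, c, d] ! i"]) (simp add: numeral_eq_Suc)
  qed
  then obtain q :: "nat \<Rightarrow> nat \<Rightarrow> int" where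
    q: "\<And>z. int z = (q z 0)\<^sup>2 + (q z 1)\<^sup>2 + (q z 2)\<^sup>2 + (q z 3)\<^sup>2" by metis
  \<comment> \<open>Block \<open>i\<close> occupies the indices \<open>j\<close> with
    \<open>j + 2 = 4 * i + c\<close> and \<open>c < 4\<close>, so division by 4 recovers the block
    and the remainder the place in it.\<close>
  define x where "x = (\<lambda>j. if j = 1 then int (zs ! 0)
    else if j \<in> {1..4 * m + 5} then q (zs ! ((j + 2) div 4)) ((j + 2) mod 4) else undefined)"
  have "square_coords x i = int (zs ! i)" if "i < m + 2" for i
  proof (cases "i = 0")
    case False
    have x: "x j = q (zs ! i) c" if "j + 2 = 4 * i + c" "c < 4" for j c
    proof -
      have "(j + 2) div 4 = i" "(j + 2) mod 4 = c"
        unfolding that(1) using that(2) by simp_all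
      moreover have "j \<noteq> 1" "j \<in> {1..4 * m + 5}"
        using that False \<open>i < m + 2\<close> by auto
      ultimately show ?thesis by (simp add: x_def)
    qed
    have "x (4 * i - 2) = q (zs ! i) 0" "x (4 * i - 1) = q (zs ! i) 1"
      "x (4 * i) = q (zs ! i) 2" "x (4 * i + 1) = q (zs ! i) 3"
      by (rule x; use False in simp)+
    thus ?thesis using False q[of "zs ! i"] by (simp add: square_coords_def)
  qed (simp add: square_coords_def x_def)
  moreover have "x \<in> {1..4 * m + 5} \<rightarrow>\<^sub>E UNIV" "x 1 = int (zs ! 0)" by (auto simp: x_def)
  ultimately show thesis using that by blast
qed

text \<open>An integer is at most its square in absolute value, and that square is one summand of a
  block sum. Bounds on natural zeros thus carry over to integer zeros.\<close>

lemma abs_le_square_coords: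
  assumes "j \<in> {2..4 * m + 5}"
  obtains i where "i < m + 2" "\<bar>x j\<bar> \<le> square_coords x i"
proof
  let ?i = "(j + 2) div 4"
  show "?i < m + 2" using assms by auto
  have "?i \<noteq> 0" "j = 4 * ?i - 2 \<or> j = 4 * ?i - 1 \<or> j = 4 * ?i \<or> j = 4 * ?i + 1"
    using assms by (simp, presburger)+
  hence "(x j)\<^sup>2 \<le> square_coords x ?i"
    unfolding square_coords_def by (elim disjE) simp_all
  moreover have "\<bar>x j\<bar> \<le> (x j)\<^sup>2"
    using self_le_power[of "\<bar>x j\<bar>" 2] by (cases "x j = 0") auto
  ultimately show "\<bar>x j\<bar> \<le> square_coords x ?i" by linarith
qed

lemma square_coords_nonneg: "0 \<le> x 1 \<Longrightarrow> 0 \<le> square_coords x i"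
  by (simp add: square_coords_def)

section \<open>Integer zeros for a fixed parameter\<close>

context
  fixes f :: "nat \<Rightarrow> nat" and m :: nat and W :: int_mpoly
  assumes rep: "diophantine_representation 2 {[n, y] | n y. y < f n} m W"
    and ff: "finite_fold 2 m W"
begin

lemma less_iff_ex_zero: "y < f n \<longleftrightarrow> (\<exists>xs\<in>tuples m. mpoly_at W ([n, y] @ xs) = 0)"
proof -
  have "[n, y] \<in> tuples 2" by (simp add: tuples_def)
  hence "[n, y] \<in> {[n, y] | n y. y < f n} \<longleftrightarrow> (\<exists>xs\<in>tuples m. mpoly_at W ([n, y] @ xs) = 0)"
    using rep unfolding diophantine_representation_def by blast
  thus ?thesis by simp
qed

lemma mpoly_at_eq_mpoly_eval:
  assumes "length zs = m + 2" "\<And>i. i < m + 2 \<Longrightarrow> v i = int (zs ! i)"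
  shows "mpoly_at W zs = mpoly_eval W v"
  unfolding mpoly_at_def
  by (rule mpoly_eval_cong)
    (use assms rep in \<open>auto simp: diophantine_representation_def\<close>)

text \<open>Finite-foldness bounds the zeros only for fixed \<open>n\<close> and \<open>y\<close>;
  but a zero forces \<open>y < f n\<close>, which leaves finitely many \<open>y\<close>.\<close>

lemma finite_nat_zeros: "finite {zs. length zs = m + 2 \<and> zs ! 0 = n \<and> mpoly_at W zs = 0}"
proof (rule finite_subset)
  let ?X = "\<lambda>y. {xs \<in> tuples m. mpoly_at W ([n, y] @ xs) = 0}"
  show "{zs. length zs = m + 2 \<and> zs ! 0 = n \<and> mpoly_at W zs = 0} \<subseteq>
      (\<Union>y<f n. (\<lambda>xs. [n, y] @ xs) ` ?X y)"
  proof
    fix zs assume "zs \<in> {zs. length zs = m + 2 \<and> zs ! 0 = n \<and> mpoly_at W zs = 0}"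
    then obtain y xs where zs: "zs = [n, y] @ xs" "length xs = m" "mpoly_at W ([n, y] @ xs) = 0"
      by (auto simp: length_Suc_conv)
    hence "xs \<in> ?X y" by (simp add: tuples_def)
    moreover from this have "y < f n" using less_iff_ex_zero by blast
    ultimately show "zs \<in> (\<Union>y<f n. (\<lambda>xs. [n, y] @ xs) ` ?X y)" using zs(1) by auto
  qed
  have "[n, y] \<in> tuples 2" for y by (simp add: tuples_def)
  hence "finite (?X y)" for y using ff unfolding finite_fold_def by blast
  thus "finite (\<Union>y<f n. (\<lambda>xs. [n, y] @ xs) ` ?X y)" by blast
qed

text \<open>Finitely many natural zeros have a common bound \<open>B\<close> on their entries; it
  bounds all block sums and hence all integer variables.\<close>

lemma finite_parameter_zeros: "finite (parameter_zeros m W n)"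
proof -
  let ?T = "{zs. length zs = m + 2 \<and> zs ! 0 = n \<and> mpoly_at W zs = 0}"
  have "finite (\<Union>zs\<in>?T. set zs)" using finite_nat_zeros by blast
  then obtain B where B: "\<And>z zs. zs \<in> ?T \<Longrightarrow> z \<in> set zs \<Longrightarrow> z \<le> B"
    unfolding finite_nat_set_iff_bounded_le by blast
  have "parameter_zeros m W n \<subseteq> {1..4 * m + 5} \<rightarrow>\<^sub>E {- int B..int B}"
  proof
    fix x assume x: "x \<in> parameter_zeros m W n"
    hence x1: "x 1 = int n" by (simp add: parameter_zeros_def)
    \<comment> \<open>\<open>nat\<close> loses nothing: block sums are nonnegative, and so is the
      parameter \<open>x 1 = int n\<close>.\<close>
    let ?zs = "map (\<lambda>i. nat (square_coords x i)) [0..<m + 2]"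
    have zs: "square_coords x i = int (?zs ! i)" if "i < m + 2" for i
      using that square_coords_nonneg[of x i] x1 by (simp del: upt_Suc)
    have "mpoly_at W ?zs = mpoly_eval W (square_coords x)"
      by (rule mpoly_at_eq_mpoly_eval[OF _ zs]) simp
    moreover have "?zs ! 0 = n" using x1 by (simp add: square_coords_def del: upt_Suc)
    ultimately have T: "?zs \<in> ?T" using x by (simp add: parameter_zeros_def del: upt_Suc)
    have b: "square_coords x i \<le> int B" if "i < m + 2" for i
    proof -
      have "?zs ! i \<in> set ?zs" using that by (intro nth_mem) simp
      hence "?zs ! i \<le> B" by (rule B[OF T])
      thus ?thesis using zs[OF that] by linarith
    qed
    have "\<bar>x j\<bar> \<le> int B" if j: "j \<in> {1..4 * m + 5}" for j
    proof (cases "j = 1")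
      case True
      thus ?thesis using b[of 0] x1 by (simp add: square_coords_def)
    next
      case False
      hence "j \<in> {2..4 * m + 5}" using j by auto
      then obtain i where "i < m + 2" "\<bar>x j\<bar> \<le> square_coords x i"
        using abs_le_square_coords by blast
      thus ?thesis using b[of i] by linarith
    qed
    thus "x \<in> {1..4 * m + 5} \<rightarrow>\<^sub>E {- int B..int B}"
      using x by (force simp: parameter_zeros_def PiE_def abs_le_iff)
  qed
  thus ?thesis by (rule finite_subset) (simp add: finite_PiE)
qed

text \<open>The first block sum of a zero reads off \<open>y\<close>, and every
  \<open>y < f n\<close> occurs in this way.\<close>

lemma card_parameter_zeros: "f n \<le> card (parameter_zeros m W n)"
proof -
  have "{..<f n} \<subseteq> (\<lambda>x. nat (square_coords x 1)) ` parameter_zeros m W n"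
  proof
    fix y assume "y \<in> {..<f n}"
    then obtain xs where xs: "xs \<in> tuples m" "mpoly_at W ([n, y] @ xs) = 0"
      using less_iff_ex_zero by auto
    let ?zs = "[n, y] @ xs"
    have len: "length ?zs = m + 2" using xs by (simp add: tuples_def)
    then obtain x where x: "x \<in> {1..4 * m + 5} \<rightarrow>\<^sub>E UNIV" "x 1 = int (?zs ! 0)"
      "\<And>i. i < m + 2 \<Longrightarrow> square_coords x i = int (?zs ! i)"
      using square_coords_surj by blast
    have "mpoly_eval W (square_coords x) = 0"
      using mpoly_at_eq_mpoly_eval[OF len x(3)] xs(2) by simp
    hence "x \<in> parameter_zeros m W n" using x by (simp add: parameter_zeros_def)
    moreover have "y = nat (square_coords x 1)" using x(3)[of 1] by simp
    ultimately show "y \<in> (\<lambda>x. nat (square_coords x 1)) ` parameter_zeros m W n" by blast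
  qed
  thus ?thesis using surj_card_le[OF finite_parameter_zeros] by fastforce
qed

end

section \<open>The system for each large \<open>n\<close>\<close>

theorem theorem1:
  fixes f :: "nat \<Rightarrow> nat"
  assumes "matiyasevich_conjecture"
    and "computable f"
  shows "\<exists>m>0. \<forall>n\<ge>m. \<exists>S\<subseteq>E n.
           finite (int_solutions n S) \<and> card (int_solutions n S) \<ge> f n"
proof -
  have "recursively_enumerable 2 {[n, y] | n y. y < f n}"
    using assms(2) by (rule recursively_enumerable_less_computable)
  then obtain m W where W: "diophantine_representation 2 {[n, y] | n y. y < f n} m W"
    "finite_fold 2 m W"
    using assms(1) unfolding matiyasevich_conjecture_def by (meson zero_less_numeral)
  let ?D = "4 * m + 5"
  have "definable ?D (\<lambda>x. square_coords x i)" if "i \<in> mpoly_vars W" for i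
  proof (cases "i = 0")
    case True
    thus ?thesis by (simp add: square_coords_def definable_var)
  next
    case False
    moreover have "i < m + 2" using that W(1) by (auto simp: diophantine_representation_def)
    ultimately show ?thesis
      by (auto simp: square_coords_def intro!: definable_add definable_power definable_var)
  qed
  hence "definable ?D (\<lambda>x. mpoly_eval W (square_coords x))"
    by (rule definable_mpoly_eval)
  then obtain N S where S: "?D \<le> N" "S \<subseteq> E N"
    "bij_betw (\<lambda>x. restrict x {1..?D}) (int_solutions N S)
      {x \<in> {1..?D} \<rightarrow>\<^sub>E UNIV. mpoly_eval W (square_coords x) = 0}"
    by (rule definable_zeros)
  show ?thesis
  \<comment> \<open>\<open>N\<close> was obtained from \<open>W\<close> alone, before
    \<open>n\<close> is chosen, so \<open>2 * N\<close> is a legitimate threshold.\<close>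
  proof (intro exI[of _ "2 * N"] conjI allI impI)
    show "2 * N > 0" using S(1) by simp
  next
    fix n assume n: "n \<ge> 2 * N"
    \<comment> \<open>Variable 1 carries the parameter, so this is the one forced to equal
      \<open>n\<close>.\<close>
    let ?C = "counting_system N 1 n \<union> S"
    have bij1: "bij_betw (\<lambda>x. restrict x {1..?D}) {x \<in> int_solutions N S. x 1 = int n}
        (parameter_zeros m W n)"
      using S(3) unfolding bij_betw_def parameter_zeros_def inj_on_def by (auto 0 3)
    have bij2: "bij_betw (\<lambda>x. restrict x {1..N}) (int_solutions n ?C)
        {x \<in> int_solutions N S. x 1 = int n}"
      using S n by (intro counting_system(2)) auto
    note bij = bij_betw_trans[OF bij2 bij1]
    show "\<exists>S\<subseteq>E n. finite (int_solutions n S) \<and> f n \<le> card (int_solutions n S)"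
    proof (intro exI[of _ ?C] conjI)
      show "?C \<subseteq> E n" using S n by (intro counting_system(1)) auto
      show "finite (int_solutions n ?C)"
        using bij_betw_finite[OF bij] finite_parameter_zeros[OF W] by simp
      show "f n \<le> card (int_solutions n ?C)"
        using bij_betw_same_card[OF bij] card_parameter_zeros[OF W, of n] by simp
    qed
  qed
qed

end
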